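(* Let $J\subset(0,\infty)$ be an interval. If $f:J\to(0,\infty)$ is a differentiable log-convex function, then for any $s,t\in J$, $$\exp\left(\frac{f'(s)}{f(s)}(t-s)\right)\le \frac{f(t)}{f(s)}\le \exp\left(\frac{f'(t)}{f(t)}(t-s)\right).$$ If $f:J\to(0,\infty)$ is a differentiable log-concave function, then for any $s,t\in J$, $$\exp\left(\frac{f'(t)}{f(t)}(s-t)\right)\le \frac{f(t)}{f(s)}\le \exp\left(\frac{f'(s)}{f(s)}(s-t)\right).$$
   Context: A function $f:J\to(0,\infty)$ is log-convex if $f((1-\lambda)a+\lambda b)\le f(a)^{1-\lambda}f(b)^{\lambda}$ for all $a,b\in J$ and $0\le\lambda\le1$, i.e. $\log f$ is convex; it is log-concave if $-\log f$ is convex.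
   Formalization: In the log-concave part the factor (s-t) in both exponents is replaced by (t-s), since the printed bounds are false: for f=exp, s=1, t=2 they would give e ≤ 1/e. *)

theory Defs
  imports "HOL-Analysis.Analysis"
begin

text \<open>Both notions are meant for an interval \<open>J\<close> and a function that is positive on \<open>J\<close>;
  \<open>powr\<close> and \<open>ln\<close> have no mathematical meaning at negative arguments.\<close>

definition log_convex_on :: "real set \<Rightarrow> (real \<Rightarrow> real) \<Rightarrow> bool" where
  "log_convex_on J f \<longleftrightarrow>
    (\<forall>a\<in>J. \<forall>b\<in>J. \<forall>u. 0 \<le> u \<longrightarrow> u \<le> 1 \<longrightarrow>
      f ((1 - u) * a + u * b) \<le> f a powr (1 - u) * f b powr u)"

text \<open>With this definition \<open>f' t / f t * (t - s) \<le> ln (f t / f s) \<le> f' s / f s * (t - s)\<close>. Under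
  the factor \<open>s - t\<close> printed in the source the bounds fail, e.g. for \<open>f = exp\<close>, \<open>s = 1\<close>, \<open>t = 2\<close>;
  the factor is therefore read as \<open>t - s\<close>.\<close>

definition log_concave_on :: "real set \<Rightarrow> (real \<Rightarrow> real) \<Rightarrow> bool" where
  "log_concave_on J f \<longleftrightarrow> convex_on J (\<lambda>x. - ln (f x))"

lemma log_convex_on_iff_convex_on_ln:
  assumes "is_interval J" and pos: "\<And>x. x \<in> J \<Longrightarrow> 0 < f x"
  shows "log_convex_on J f \<longleftrightarrow> convex_on J (\<lambda>x. ln (f x))"
proof -
  have cv: "convex J"
    using assms(1) by (simp add: is_interval_convex)
  have eq: "f ((1 - l) * a + l * b) \<le> f a powr (1 - l) * f b powr l \<longleftrightarrow>
      ln (f ((1 - l) * a + l * b)) \<le> (1 - l) * ln (f a) + l * ln (f b)"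
    if "a \<in> J" "b \<in> J" "0 \<le> l" "l \<le> 1" for a b l
  proof -
    have "(1 - l) * a + l * b \<in> J"
      using convexD_alt[OF cv that(1,2,3,4)] by simp
    then have p: "0 < f ((1 - l) * a + l * b)" "0 < f a" "0 < f b"
      using pos that by auto
    have "f a powr (1 - l) * f b powr l = exp ((1 - l) * ln (f a) + l * ln (f b))"
      using p by (simp add: powr_def exp_add)
    then show ?thesis
      using p by (simp add: ln_le_cancel_iff[symmetric] del: ln_le_cancel_iff)
  qed
  show ?thesis
  proof
    assume L: "log_convex_on J f"
    show "convex_on J (\<lambda>x. ln (f x))"
    proof (rule convex_onI)
      fix t x y :: real
      assume "0 < t" "t < 1" "x \<in> J" "y \<in> J"
      then show "ln (f ((1 - t) *\<^sub>R x + t *\<^sub>R y)) \<le> (1 - t) * ln (f x) + t * ln (f y)"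
        using L eq[of x y t] unfolding log_convex_on_def by simp
    qed (rule cv)
  next
    assume "convex_on J (\<lambda>x. ln (f x))"
    then show "log_convex_on J f"
      unfolding log_convex_on_def using eq convex_onD[of J "\<lambda>x. ln (f x)"] by simp
  qed
qed

end

theory Submission imports Defs begin

text \<open>For a convex function the secant slopes from \<open>s\<close> towards \<open>t\<close> are bounded by the full secant slope,
  so the derivative at \<open>s\<close>, one-sided if \<open>s\<close> is an endpoint, gives a supporting line.  Applied to
  \<open>\<plusminus> ln f\<close> at \<open>s\<close> and at \<open>t\<close>, this bounds \<open>ln (f t / f s)\<close> from both sides.\<close>

text \<open>Unlike \<open>convex_on_imp_above_tangent\<close>, this covers the boundary points of \<open>J\<close>.\<close>
lemma convex_on_above_tangent_within:
  fixes g :: "real \<Rightarrow> real"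
  assumes convex: "convex_on J g" and s: "s \<in> J" and t: "t \<in> J"
    and deriv: "(g has_real_derivative D) (at s within J)"
  shows "D * (t - s) \<le> g t - g s"
proof -
  \<comment> \<open>Running along the segment from \<open>s\<close> to \<open>t\<close> turns the
    claim into a one-sided limit at parameter 0, whatever the order of \<open>s\<close> and
    \<open>t\<close>, with \<open>s = t\<close> included.\<close>
  define p where "p = (\<lambda>u. s + u * (t - s))"
  have p_eq: "p u = (1 - u) *\<^sub>R s + u *\<^sub>R t" for u
    by (simp add: p_def algebra_simps)
  \<comment> \<open>Since the segment stays in \<open>J\<close>, the derivative within
    \<open>J\<close> restricts to it, as the chain rule requires.\<close>
  have "p ` {0..1} \<subseteq> J"
    using convexD_alt[OF convex_on_imp_convex[OF convex] s t] by (auto simp: p_eq)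
  then have "(g has_real_derivative D) (at (p 0) within p ` {0..1})"
    using deriv by (auto simp: p_def intro: DERIV_subset)
  moreover have "(p has_real_derivative t - s) (at 0 within {0..1})"
    unfolding p_def by (auto intro!: derivative_eq_intros)
  ultimately have "((g \<circ> p) has_real_derivative D * (t - s)) (at 0 within {0..1})"
    by (rule DERIV_image_chain)
  then have lim: "((\<lambda>u. (g (p u) - g s) / u) \<longlongrightarrow> D * (t - s)) (at 0 within {0..1})"
    by (simp add: has_field_derivative_iff p_def)
  have slope: "(g (p u) - g s) / u \<le> g t - g s" if "0 < u" "u \<le> 1" for u
  proof -
    have "g (p u) \<le> (1 - u) * g s + u * g t"
      unfolding p_eq using that s t by (intro convex_onD[OF convex]) auto
    then have "g (p u) - g s \<le> (g t - g s) * u"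
      by (simp add: algebra_simps)
    then show ?thesis
      using that by (simp add: pos_divide_le_eq)
  qed
  \<comment> \<open>The filter omits \<open>u = 0\<close>, so \<open>slope\<close> applies at every
    remaining point of the unit interval.\<close>
  have "\<forall>\<^sub>F u in at 0 within {0..1}. (g (p u) - g s) / u \<le> g t - g s"
    unfolding eventually_at_filter by (rule always_eventually) (auto intro: slope)
  moreover have "at (0::real) within {0..1} \<noteq> bot"
    by (simp add: at_within_Icc_at_right)
  ultimately show ?thesis
    using lim by (intro tendsto_upperbound)
qed

theorem theorem2p7:
  fixes J :: "real set" and f f' :: "real \<Rightarrow> real"
  assumes "is_interval J" and "J \<subseteq> {0<..}"
    and "\<And>x. x \<in> J \<Longrightarrow> 0 < f x"
    and "\<And>x. x \<in> J \<Longrightarrow> (f has_real_derivative f' x) (at x within J)"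
  shows "(log_convex_on J f \<longrightarrow>
      (\<forall>s\<in>J. \<forall>t\<in>J.
        exp (f' s / f s * (t - s)) \<le> f t / f s \<and>
        f t / f s \<le> exp (f' t / f t * (t - s)))) \<and>
    (log_concave_on J f \<longrightarrow>
      (\<forall>s\<in>J. \<forall>t\<in>J.
        exp (f' t / f t * (t - s)) \<le> f t / f s \<and>
        f t / f s \<le> exp (f' s / f s * (t - s))))"
proof -
  let ?g = "\<lambda>x. ln (f x)"
  have deriv: "(?g has_real_derivative f' x / f x) (at x within J)" if "x \<in> J" for x
    using assms(3)[OF that] assms(4)[OF that]
    by (auto intro!: derivative_eq_intros simp: field_simps)
  have ratio: "f t / f s = exp (?g t - ?g s)" if "s \<in> J" "t \<in> J" for s t
    using assms(3) that by (simp add: exp_diff)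
  have "f' s / f s * (t - s) \<le> ?g t - ?g s \<and> ?g t - ?g s \<le> f' t / f t * (t - s)"
    if "log_convex_on J f" "s \<in> J" "t \<in> J" for s t
  proof -
    have "convex_on J ?g"
      using that(1) log_convex_on_iff_convex_on_ln[of J f] assms(1,3) by blast
    note tangent = convex_on_above_tangent_within[OF this _ _ deriv]
    \<comment> \<open>The tangent at \<open>s\<close> evaluated at \<open>t\<close> gives the lower
      bound; the tangent at \<open>t\<close> evaluated at \<open>s\<close> gives the upper one after
      a change of sign.\<close>
    show ?thesis
      using tangent[of s t] tangent[of t s] that(2,3) by (simp add: right_diff_distrib)
  qed
  moreover have "f' t / f t * (t - s) \<le> ?g t - ?g s \<and> ?g t - ?g s \<le> f' s / f s * (t - s)"
    if "log_concave_on J f" "s \<in> J" "t \<in> J" for s t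
  proof -
    have "convex_on J (\<lambda>x. - ?g x)"
      using that(1) by (simp add: log_concave_on_def)
    \<comment> \<open>The convex function is now the negative of \<open>?g\<close>, with derivative
      \<open>- (f' x / f x)\<close>, so the tangents at \<open>s\<close> and \<open>t\<close>
      exchange roles.\<close>
    note tangent = convex_on_above_tangent_within[OF this _ _ DERIV_minus[OF deriv]]
    show ?thesis
      using tangent[of s t] tangent[of t s] that(2,3) by (simp add: right_diff_distrib)
  qed
  ultimately show ?thesis
    by (simp add: ratio)
qed

end
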